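(* Let $\mathbf{X}=(X_1,X_2,\dots)$ be a stationary, irreducible and aperiodic first-order time-homogeneous Markov chain on a finite alphabet $\mathcal{X}$ with transition probability matrix $\mathbb{P}=[P_{x\to x'}]$ and invariant distribution $\boldsymbol{\mu}=(\mu_x)_{x\in\mathcal{X}}$, and let $g:\mathcal{X}\to\mathcal{Y}$ be a surjective function onto a finite set $\mathcal{Y}$. Let $\mathbb{W}=[W_{x\to y}]$ be the $|\mathcal{X}|\times|\mathcal{Y}|$ matrix with $W_{x\to y}=1$ if $y=g(x)$ and $W_{x\to y}=0$ otherwise, let $\boldsymbol{\nu}^T:=\boldsymbol{\mu}^T\mathbb{W}$, $\mathbb{U}:=\mathrm{diag}(\boldsymbol{\nu})^{-1}\mathbb{W}^T\mathrm{diag}(\boldsymbol{\mu})$ and $\mathbb{Q}=[Q_{y\to y'}]:=\mathbb{U}\mathbb{P}\mathbb{W}$. Let $\tilde{\mathbf{Y}}$ be the stationary Markov chain on $\mathcal{Y}$ with transition probability matrix $\mathbb{Q}$. Then $\mathbf{X}$ and $\tilde{\mathbf{Y}}$ are $\varepsilon$-bisimilar with $$\varepsilon=\sqrt{\frac{\ln(2)\,\mathcal{C}_L(\mathbf{X},g)}{2\min_{x\in\mathcal{X}}\mu_x}},$$ where $\mathcal{C}_L(\mathbf{X},g):=H(Y_2|Y_1)-H(Y_2|X_1)$ with $Y_k:=g(X_k)$.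
   Context: All vectors indexed by an alphabet are column vectors; $\mathrm{diag}(\mathbf{a})$ is the diagonal matrix with $\mathbf{a}$ on its diagonal. A stationary, irreducible, aperiodic Markov chain is started in its unique invariant distribution ($\boldsymbol{\mu}^T=\boldsymbol{\mu}^T\mathbb{P}$, and $X_1\sim\boldsymbol{\mu}$). $H(\cdot|\cdot)$ is the conditional Shannon entropy, with logarithms to base 2. Definition ($\varepsilon$-bisimulation). Consider two finite Markov chains $\mathbf{X}$ on $\mathcal{X}$ with transition matrix $\mathbb{P}=[P_{x\to x'}]$ and $\tilde{\mathbf{Y}}$ on $\mathcal{Y}$ with transition matrix $\mathbb{Q}=[Q_{y\to y'}]$, where (w.l.o.g.) $\mathcal{X}$ and $\mathcal{Y}$ are disjoint. $\mathbf{X}$ and $\tilde{\mathbf{Y}}$ are $\varepsilon$-bisimilar if there exists a relation $\mathcal{R}_\varepsilon\subseteq(\mathcal{X}\cup\mathcal{Y})\times(\mathcal{X}\cup\mathcal{Y})$ such that for all $x\in\mathcal{X}$ and $y\in\mathcal{Y}$ with $(y,x)\in\mathcal{R}_\varepsilon$, and all $T\subseteq\mathcal{X}\cup\mathcal{Y}$, $$\sum_{x'\in\mathcal{R}_\varepsilon(T)\cap\mathcal{X}}P_{x\to x'}\ \ge\ \sum_{y'\in T\cap\mathcal{Y}}Q_{y\to y'}-\varepsilon,$$ where $\mathcal{R}_\varepsilon(T):=\{s_2\in\mathcal{X}\cup\mathcal{Y}: s_1\in T,\ (s_1,s_2)\in\mathcal{R}_\varepsilon\}$. *)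

theory Defs
  imports "HOL-Probability.Probability"
begin

(* Alphabets are finite types.  Entry P $ x $ x' is the probability of moving from x to x',
   and distributions act from the left through "v*". *)

definition transition_matrix :: "real ^ 'x ^ 'x \<Rightarrow> bool" where
  "transition_matrix P \<longleftrightarrow>
     (\<forall>x x'. P $ x $ x' \<ge> 0) \<and> (\<forall>x. (\<Sum>x'\<in>UNIV. P $ x $ x') = 1)"

definition invariant_distribution :: "real ^ 'x ^ 'x \<Rightarrow> real ^ 'x \<Rightarrow> bool" where
  "invariant_distribution P \<mu> \<longleftrightarrow>
     (\<forall>x. \<mu> $ x \<ge> 0) \<and> (\<Sum>x\<in>UNIV. \<mu> $ x) = 1 \<and> \<mu> = \<mu> v* P"

(* The library's "^" on this type is the componentwise power. *)
definition mat_power :: "real ^ 'x ^ 'x \<Rightarrow> nat \<Rightarrow> real ^ 'x ^ 'x" where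
  "mat_power P n = ((\<lambda>A. A ** P) ^^ n) (mat 1)"

definition irreducible_matrix :: "real ^ 'x ^ 'x \<Rightarrow> bool" where
  "irreducible_matrix P \<longleftrightarrow> (\<forall>x x'. \<exists>n>0. mat_power P n $ x $ x' > 0)"

definition aperiodic_matrix :: "real ^ 'x ^ 'x \<Rightarrow> bool" where
  "aperiodic_matrix P \<longleftrightarrow> (\<forall>x. Gcd {n. n > 0 \<and> mat_power P n $ x $ x > 0} = 1)"

(* Time starts at 1; the value of the process at time 0 is irrelevant. *)
definition markov_chain ::
  "'w measure \<Rightarrow> (nat \<Rightarrow> 'w \<Rightarrow> 'x::finite) \<Rightarrow> real ^ 'x ^ 'x \<Rightarrow> bool" where
  "markov_chain M X P \<longleftrightarrow>
     prob_space M \<and>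
     (\<forall>n\<ge>1. X n \<in> measurable M (count_space UNIV)) \<and>
     transition_matrix P \<and>
     (\<forall>n\<ge>1. \<forall>s. \<P>(\<omega> in M. \<forall>i\<in>{1..n}. X i \<omega> = s i) > 0 \<longrightarrow>
        \<P>(\<omega> in M. X (n + 1) \<omega> = s (n + 1) \<bar> \<forall>i\<in>{1..n}. X i \<omega> = s i) = P $ s n $ s (n + 1))"

definition stationary_markov_chain ::
  "'w measure \<Rightarrow> (nat \<Rightarrow> 'w \<Rightarrow> 'x::finite) \<Rightarrow> real ^ 'x ^ 'x \<Rightarrow> real ^ 'x \<Rightarrow> bool" where
  "stationary_markov_chain M X P \<mu> \<longleftrightarrow>
     markov_chain M X P \<and> invariant_distribution P \<mu> \<and>
     (\<forall>x. \<P>(\<omega> in M. X 1 \<omega> = x) = \<mu> $ x)"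

definition diag_matrix :: "real ^ 'n \<Rightarrow> real ^ 'n ^ 'n" where
  "diag_matrix a = (\<chi> i j. if i = j then a $ i else 0)"

definition aggregation_matrix :: "('x \<Rightarrow> 'y) \<Rightarrow> real ^ 'y ^ 'x" where
  "aggregation_matrix g = (\<chi> x y. if y = g x then 1 else 0)"

(* For finitely valued random variables this is the library's H(A | B), which uses the
   same counting measures, with logarithms to base 2. *)
definition cond_entropy :: "'w measure \<Rightarrow> ('w \<Rightarrow> 'a) \<Rightarrow> ('w \<Rightarrow> 'b) \<Rightarrow> real" where
  "cond_entropy M A B =
     prob_space.conditional_entropy M 2 (count_space (A ` space M)) (count_space (B ` space M)) A B"

definition lumpability_cost :: "'w measure \<Rightarrow> (nat \<Rightarrow> 'w \<Rightarrow> 'x) \<Rightarrow> ('x \<Rightarrow> 'y) \<Rightarrow> real" where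
  "lumpability_cost M X g =
     cond_entropy M (g \<circ> X 2) (g \<circ> X 1) - cond_entropy M (g \<circ> X 2) (X 1)"

(* The disjoint union of the alphabets is the sum type, and R `` T is the set of states
   related to some element of T. *)
definition eps_bisimulation ::
  "real ^ 'x ^ 'x \<Rightarrow> real ^ 'y ^ 'y \<Rightarrow> real \<Rightarrow> ('x + 'y) rel \<Rightarrow> bool" where
  "eps_bisimulation P Q \<epsilon> R \<longleftrightarrow>
     (\<forall>x y T. (Inr y, Inl x) \<in> R \<longrightarrow>
        (\<Sum>x' | Inl x' \<in> R `` T. P $ x $ x') \<ge> (\<Sum>y' | Inr y' \<in> T. Q $ y $ y') - \<epsilon>)"

(* Bisimilarity is a property of the two transition matrices.  The empty relation is always
   admissible here, so statements of substance should also name the relation. *)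
definition eps_bisimilar :: "real ^ 'x ^ 'x \<Rightarrow> real ^ 'y ^ 'y \<Rightarrow> real \<Rightarrow> bool" where
  "eps_bisimilar P Q \<epsilon> \<longleftrightarrow> (\<exists>R. eps_bisimulation P Q \<epsilon> R)"

end

theory Submission
  imports Defs
begin

text \<open>Let \<open>S\<close> be the matrix \<open>P W\<close>, whose row \<open>x\<close> is the law of \<open>Y\<^sub>2\<close> given \<open>X\<^sub>1 = x\<close>. Up to the factor
  \<open>ln 2\<close>, the lumpability cost is the \<open>\<mu>\<close>-average over \<open>x\<close> of the divergence of this row from row \<open>g x\<close>
  of \<open>Q\<close>. Every divergence is non-negative, so the cost dominates each single term weighted by the
  least mass of \<open>\<mu>\<close>. Pinsker's inequality turns this into a bound on \<open>Q(g x, B) - S(x, B)\<close> uniform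
  in \<open>x\<close> and \<open>B\<close>, which is the bisimulation inequality for the graph of \<open>g\<close>, since \<open>S(x, B)\<close> is the
  probability of moving from \<open>x\<close> into the preimage of \<open>B\<close>.\<close>

section \<open>Pinsker's inequality\<close>

text \<open>This is the lower bound in the Donsker-Varadhan variational formula for relative
  entropy. Tilting \<open>q\<close> by \<open>exp f\<close> and dividing by the normaliser
  \<open>Z\<close> gives a law of total mass 1; \<open>ln r \<le> r - 1\<close> for the ratio
  \<open>r\<close> of that law to \<open>p\<close>, averaged over \<open>p\<close>, has right-hand
  side 1 - 1 = 0.\<close>

lemma sum_Gibbs_exponential_tilt:
  fixes p q f :: "'a \<Rightarrow> real"
  assumes "finite I"
    and p: "\<And>i. i \<in> I \<Longrightarrow> p i \<ge> 0" "sum p I = 1"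
    and q: "\<And>i. i \<in> I \<Longrightarrow> q i \<ge> 0"
    and ac: "\<And>i. i \<in> I \<Longrightarrow> q i = 0 \<Longrightarrow> p i = 0"
  shows "(\<Sum>i\<in>I. p i * f i) - ln (\<Sum>i\<in>I. q i * exp (f i)) \<le> (\<Sum>i\<in>I. p i * ln (p i / q i))"
proof -
  define Z where "Z = (\<Sum>i\<in>I. q i * exp (f i))"
  \<comment> \<open>An index charged by \<open>p\<close> is charged by \<open>q\<close> as well, by
    \<open>ac\<close>; its term alone makes \<open>Z\<close> positive, so \<open>ln Z\<close> is a
    genuine logarithm.\<close>
  obtain j where j: "j \<in> I" "p j \<noteq> 0"
    using p(2) by (metis sum.neutral zero_neq_one)
  have "q j * exp (f j) > 0"
    using j ac[of j] q[of j] by fastforce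
  also have "q j * exp (f j) \<le> Z"
    unfolding Z_def using \<open>finite I\<close> j q by (intro member_le_sum) auto
  finally have Z: "Z > 0" .
  have "p i * f i - p i * ln Z - p i * ln (p i / q i) \<le> q i * exp (f i) / Z - p i" if i: "i \<in> I" for i
  proof (cases "p i = 0")
    case True
    then show ?thesis using q[OF i] Z by simp
  next
    case False
    have pi: "p i > 0" and qi: "q i > 0"
      using False p(1)[OF i] q[OF i] ac[OF i] by force+
    define r where "r = q i * exp (f i) / (Z * p i)"
    have r: "r > 0" using pi qi Z by (simp add: r_def)
    have "ln r = f i - ln Z - ln (p i / q i)"
      using pi qi Z by (simp add: r_def ln_mult ln_div)
    then have "p i * f i - p i * ln Z - p i * ln (p i / q i) = p i * ln r"
      by (simp only: right_diff_distrib)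
    also have "\<dots> \<le> p i * (r - 1)"
      using ln_le_minus_one[OF r] pi by simp
    also have "\<dots> = q i * exp (f i) / Z - p i"
      using pi Z by (simp add: r_def field_simps)
    finally show ?thesis .
  qed
  then have "(\<Sum>i\<in>I. p i * f i - p i * ln Z - p i * ln (p i / q i)) \<le> (\<Sum>i\<in>I. q i * exp (f i) / Z - p i)"
    by (rule sum_mono)
  also have "\<dots> = 0"
    using Z p(2) by (simp add: sum_subtractf Z_def flip: sum_divide_distrib)
  finally have "(\<Sum>i\<in>I. p i * f i) - ln Z * sum p I - (\<Sum>i\<in>I. p i * ln (p i / q i)) \<le> 0"
    by (simp add: sum_subtractf sum_distrib_left mult.commute)
  then show ?thesis
    unfolding Z_def using p(2) by simp
qed

text \<open>Tilting by \<open>4 * d\<close> on the event maximises the bound \<open>h * d - h\<^sup>2 / 8\<close> supplied by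
  Hoeffding's lemma.\<close>

lemma Pinsker_event:
  fixes p q :: "'a \<Rightarrow> real"
  assumes fin: "finite I" and A: "A \<subseteq> I"
    and p: "\<And>i. i \<in> I \<Longrightarrow> p i \<ge> 0" "sum p I = 1"
    and q: "\<And>i. i \<in> I \<Longrightarrow> q i \<ge> 0" "sum q I = 1"
    and ac: "\<And>i. i \<in> I \<Longrightarrow> q i = 0 \<Longrightarrow> p i = 0"
  shows "2 * (sum p A - sum q A)\<^sup>2 \<le> (\<Sum>i\<in>I. p i * ln (p i / q i))"
proof -
  \<comment> \<open>The tilt is to be non-negative, so events to which \<open>p\<close> gives at
    least the mass of \<open>q\<close> come first.\<close>
  have oriented: "2 * (sum p B - sum q B)\<^sup>2 \<le> (\<Sum>i\<in>I. p i * ln (p i / q i))"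
    if B: "B \<subseteq> I" and le: "sum q B \<le> sum p B" for B
  proof -
    define d where "d = sum p B - sum q B"
    define h where "h = 4 * d"
    have h: "h \<ge> 0" using le by (simp add: h_def d_def)
    have IB: "I \<inter> B = B" using B by blast
    have p_tilt: "(\<Sum>i\<in>I. p i * (if i \<in> B then h else 0)) = h * sum p B"
      using fin IB by (simp add: if_distrib sum.If_cases sum_distrib_left mult.commute cong: if_cong)
    have "(\<Sum>i\<in>I. q i * exp (if i \<in> B then h else 0)) = (\<Sum>i\<in>I. q i + (if i \<in> B then q i * (exp h - 1) else 0))"
      by (intro sum.cong) (auto simp: algebra_simps)
    also have "\<dots> = 1 + sum q B * (exp h - 1)"
      using fin IB q(2) by (simp add: sum.distrib sum.If_cases sum_distrib_right)
    finally have q_tilt: "(\<Sum>i\<in>I. q i * exp (if i \<in> B then h else 0)) = 1 + sum q B * (exp h - 1)" .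
    have "h * sum p B - ln (1 + sum q B * (exp h - 1)) \<le> (\<Sum>i\<in>I. p i * ln (p i / q i))"
      using sum_Gibbs_exponential_tilt[of I p q "\<lambda>i. if i \<in> B then h else 0"] fin p q(1) ac
      unfolding p_tilt q_tilt by blast
    \<comment> \<open>The left side is the log-moment generating function at \<open>h\<close> of the
      centred indicator of \<open>B\<close> under \<open>q\<close>.\<close>
    moreover have "- h * sum q B + ln (1 + sum q B * (exp h - 1)) \<le> h\<^sup>2 / 8"
      using B q(1) h by (intro Hoeffdings_lemma_aux) (auto intro: sum_nonneg)
    ultimately have "h * d - h\<^sup>2 / 8 \<le> (\<Sum>i\<in>I. p i * ln (p i / q i))"
      by (simp add: d_def algebra_simps)
    moreover have "h * d - h\<^sup>2 / 8 = 2 * d\<^sup>2"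
      by (simp add: h_def power2_eq_square)
    ultimately show ?thesis
      by (simp add: d_def)
  qed
  show ?thesis
  proof (cases "sum q A \<le> sum p A")
    case True
    then show ?thesis using oriented A by blast
  next
    case False
    \<comment> \<open>Passing to the complement flips the sign of the difference and keeps its
      square.\<close>
    have "sum p (I - A) = 1 - sum p A" "sum q (I - A) = 1 - sum q A"
      using fin A p(2) q(2) by (simp_all add: sum_diff)
    then show ?thesis
      using oriented[of "I - A"] False by (simp add: power2_commute)
  qed
qed

section \<open>Invariant distributions and the aggregated chain\<close>

lemma invariant_mat_power:
  assumes "\<mu> = \<mu> v* P"
  shows "\<mu> v* mat_power P n = \<mu>"
  by (induction n) (simp_all add: mat_power_def assms[symmetric] flip: vector_matrix_mul_assoc)

lemma transition_matrix_mat_power_nonneg: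
  assumes "transition_matrix P"
  shows "mat_power P n $ x $ x' \<ge> 0"
proof (induction n arbitrary: x')
  case 0
  then show ?case by (simp add: mat_power_def mat_def)
next
  case (Suc n)
  then show ?case
    using assms unfolding mat_power_def transition_matrix_def
    by (auto simp: matrix_matrix_mult_def intro!: sum_nonneg)
qed

text \<open>Some state \<open>z\<close> carries mass, irreducibility moves a positive fraction of it
  to \<open>x\<close> in \<open>n\<close> steps, and \<mu> is unchanged by those \<open>n\<close>
  steps.\<close>

lemma invariant_distribution_pos:
  assumes P: "transition_matrix P" "irreducible_matrix P" and \<mu>: "invariant_distribution P \<mu>"
  shows "\<mu> $ x > 0"
proof -
  have nn: "\<mu> $ z \<ge> 0" for z 
    using \<mu> by (simp add: invariant_distribution_def)
  have total: "(\<Sum>z\<in>UNIV. \<mu> $ z) = 1" and inv: "\<mu> = \<mu> v* P"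
    using \<mu> by (simp_all add: invariant_distribution_def)
  obtain z where "\<mu> $ z \<noteq> 0"
    using total by (metis sum.neutral zero_neq_one)
  with nn[of z] have z: "\<mu> $ z > 0" by simp
  obtain n where n: "mat_power P n $ z $ x > 0"
    using P(2) by (auto simp: irreducible_matrix_def)
  have "0 < \<mu> $ z * mat_power P n $ z $ x" using z n by simp
  also have "\<dots> \<le> (\<Sum>z\<in>UNIV. \<mu> $ z * mat_power P n $ z $ x)"
    using nn transition_matrix_mat_power_nonneg[OF P(1)] by (intro member_le_sum) auto
  also have "\<dots> = (\<mu> v* mat_power P n) $ x"
    by (simp add: vector_matrix_mult_def mult.commute)
  also have "\<dots> = \<mu> $ x"
    by (simp add: invariant_mat_power[OF inv])
  finally show ?thesis .
qed

section \<open>Entries of the matrix products that define the aggregated chain\<close>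

lemma diag_matrix_mult_nth:
  "(diag_matrix a ** A) $ i $ j = a $ i * A $ i $ j"
  by (simp add: matrix_matrix_mult_def diag_matrix_def if_distrib if_distribR cong: if_cong)

lemma mult_diag_matrix_nth:
  "(A ** diag_matrix a) $ i $ j = A $ i $ j * a $ j"
  by (simp add: matrix_matrix_mult_def diag_matrix_def if_distrib if_distribR cong: if_cong)

lemma matrix_inv_diag_matrix:
  fixes a :: "real ^ 'n"
  assumes "\<And>i. a $ i \<noteq> 0"
  shows "matrix_inv (diag_matrix a) = diag_matrix (\<chi> i. inverse (a $ i))"
proof -
  let ?D = "diag_matrix a" and ?E = "diag_matrix (\<chi> i. inverse (a $ i))"
  have DE: "?D ** ?E = mat 1" and ED: "?E ** ?D = mat 1"
    using assms by (simp_all add: vec_eq_iff diag_matrix_mult_nth) (simp_all add: diag_matrix_def mat_def)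
  \<comment> \<open>\<open>matrix_inv\<close> is a choice among two-sided inverses: the witness
    \<open>?E\<close> makes the choice meaningful, and uniqueness of inverses then identifies it
    with \<open>?E\<close>.\<close>
  have "?D ** matrix_inv ?D = mat 1 \<and> matrix_inv ?D ** ?D = mat 1"
    unfolding matrix_inv_def using DE ED by (intro someI) blast
  then show ?thesis
    by (metis DE ED matrix_mul_assoc matrix_mul_lid matrix_mul_rid)
qed

lemma matrix_aggregation_nth:
  "(A ** aggregation_matrix g) $ i $ y = (\<Sum>x | g x = y. A $ i $ x)"
  by (simp add: matrix_matrix_mult_def aggregation_matrix_def if_distrib sum.If_cases eq_commute
      cong: if_cong)

lemma vector_aggregation_nth:
  fixes \<mu> :: "real ^ 'x"
  shows "(\<mu> v* aggregation_matrix g) $ y = (\<Sum>x | g x = y. \<mu> $ x)"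
  by (simp add: vector_matrix_mult_def aggregation_matrix_def if_distrib sum.If_cases eq_commute
      cong: if_cong)

text \<open>The factor \<open>\<nu> $ y\<close> clears the inverse. When \<mu> is the law of the
  first state, the right side is the joint probability that the lumped process is at
  \<open>y\<close> and then at \<open>y'\<close>.\<close>

lemma aggregated_transition_nth:
  fixes \<mu> :: "real ^ 'x" and P :: "real ^ 'x ^ 'x" and g :: "'x \<Rightarrow> 'y::finite"
  assumes \<nu>: "\<And>y. \<nu> $ y \<noteq> 0"
  shows "\<nu> $ y * (matrix_inv (diag_matrix \<nu>) ** transpose (aggregation_matrix g) ** diag_matrix \<mu>
      ** P ** aggregation_matrix g) $ y $ y'
    = (\<Sum>x | g x = y. \<mu> $ x * (P ** aggregation_matrix g) $ x $ y')"
proof -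
  let ?W = "aggregation_matrix g :: real ^ 'y ^ 'x"
  let ?U = "matrix_inv (diag_matrix \<nu>) ** transpose ?W ** diag_matrix \<mu>"
  have U: "?U $ y $ x = (if g x = y then \<mu> $ x / \<nu> $ y else 0)" for x
    unfolding matrix_inv_diag_matrix[OF \<nu>] mult_diag_matrix_nth diag_matrix_mult_nth
    by (simp add: transpose_def aggregation_matrix_def field_simps)
  have "(?U ** P ** ?W) $ y $ y' = (\<Sum>x\<in>UNIV. ?U $ y $ x * (P ** ?W) $ x $ y')"
    unfolding matrix_mul_assoc[symmetric, of ?U]
    by (simp add: matrix_matrix_mult_def[of ?U])
  also have "\<dots> = (\<Sum>x | g x = y. \<mu> $ x / \<nu> $ y * (P ** ?W) $ x $ y')"
    unfolding U by (rule sum.mono_neutral_cong_right) auto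
  finally show ?thesis
    using \<nu> by (simp add: sum_distrib_left)
qed

section \<open>The lumpability cost as an average divergence\<close>

text \<open>Replaces the ranges of the variables by the whole finite types: a pair of values that is
  never attained has an empty event, hence joint probability 0 and a vanishing term.\<close>

lemma cond_entropy_finite:
  fixes A :: "'w \<Rightarrow> 'a::finite" and B :: "'w \<Rightarrow> 'b::finite"
  assumes "prob_space M"
    and A: "A \<in> measurable M (count_space UNIV)" and B: "B \<in> measurable M (count_space UNIV)"
  shows "cond_entropy M A B =
    - (\<Sum>b\<in>UNIV. \<Sum>a\<in>UNIV. \<P>(\<omega> in M. A \<omega> = a \<and> B \<omega> = b) *
        log 2 (\<P>(\<omega> in M. A \<omega> = a \<and> B \<omega> = b) / \<P>(\<omega> in M. B \<omega> = b)))"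
proof -
  interpret information_space M 2
    using assms(1) by (simp add: information_space_def information_space_axioms_def)
  let ?J = "\<lambda>(a, b). \<P>(\<omega> in M. A \<omega> = a \<and> B \<omega> = b)"
  let ?f = "\<lambda>(a, b). ?J (a, b) * log 2 (?J (a, b) / \<P>(\<omega> in M. B \<omega> = b))"
  have AB: "(\<lambda>\<omega>. (A \<omega>, B \<omega>)) \<in> measurable M (count_space UNIV)"
    using measurable_Pair[OF A B] by (simp add: pair_measure_countable)
  have "simple_distributed M B (\<lambda>b. \<P>(\<omega> in M. B \<omega> = b))"
    using B by (intro simple_distributedI)
      (auto simp: simple_function_def measurable_count_space_eq2 vimage_def Int_def conj_commute
        intro!: arg_cong[of _ _ prob])
  moreover have "simple_distributed M (\<lambda>\<omega>. (A \<omega>, B \<omega>)) ?J"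
    using AB by (intro simple_distributedI)
      (auto simp: simple_function_def measurable_count_space_eq2 intro!: arg_cong[of _ _ prob])
  ultimately have "cond_entropy M A B = - (\<Sum>(a, b)\<in>(\<lambda>\<omega>. (A \<omega>, B \<omega>)) ` space M. ?f (a, b))"
    unfolding cond_entropy_def by (subst conditional_entropy_eq) auto
  also have "(\<Sum>(a, b)\<in>(\<lambda>\<omega>. (A \<omega>, B \<omega>)) ` space M. ?f (a, b)) = (\<Sum>(a, b)\<in>UNIV. ?f (a, b))"
  proof (rule sum.mono_neutral_left)
    have "?J z = 0" if "z \<notin> (\<lambda>\<omega>. (A \<omega>, B \<omega>)) ` space M" for z
    proof -
      have "{\<omega> \<in> space M. A \<omega> = fst z \<and> B \<omega> = snd z} = {}"
        using that by force
      then show ?thesis by (simp only: split_def measure_empty)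
    qed
    then show "\<forall>z\<in>UNIV - (\<lambda>\<omega>. (A \<omega>, B \<omega>)) ` space M. (case z of (a, b) \<Rightarrow> ?f (a, b)) = 0"
      by (simp add: split_def)
  qed auto
  also have "\<dots> = (\<Sum>a\<in>UNIV. \<Sum>b\<in>UNIV. ?f (a, b))"
    by (simp add: sum.cartesian_product)
  also have "\<dots> = (\<Sum>b\<in>UNIV. \<Sum>a\<in>UNIV. ?f (a, b))"
    by (rule sum.swap)
  finally show ?thesis by simp
qed

lemma stationary_markov_chain_joint:
  assumes "stationary_markov_chain M X P \<mu>"
  shows "\<P>(\<omega> in M. X 1 \<omega> = x \<and> X 2 \<omega> = x') = \<mu> $ x * P $ x $ x'"
proof -
  have chain: "markov_chain M X P" and \<mu>: "\<P>(\<omega> in M. X 1 \<omega> = x) = \<mu> $ x"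
    using assms by (auto simp: stationary_markov_chain_def)
  interpret prob_space M using chain by (simp add: markov_chain_def)
  have [measurable]: "X (Suc 0) \<in> measurable M (count_space UNIV)"
    using chain by (simp add: markov_chain_def)
  show ?thesis
  \<comment> \<open>The Markov property constrains only conditioning events of positive probability;
    for a state of mass 0 both sides vanish.\<close>
  proof (cases "\<mu> $ x > 0")
    case False
    then have "\<P>(\<omega> in M. X 1 \<omega> = x) = 0" "\<mu> $ x = 0"
      using \<mu> measure_nonneg[of M "{\<omega> \<in> space M. X 1 \<omega> = x}"] by linarith+
    moreover have "\<P>(\<omega> in M. X 1 \<omega> = x \<and> X 2 \<omega> = x') \<le> \<P>(\<omega> in M. X 1 \<omega> = x)"
      by (intro finite_measure_mono) auto
    ultimately show ?thesis
      by (simp add: measure_le_0_iff)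
  next
    case True
    \<comment> \<open>The Markov property quantifies over whole paths; at \<open>n = 1\<close> it
      reads off only the values \<open>x\<close> at time 1 and \<open>x'\<close> at time 2.\<close>
    define s where "s = (\<lambda>n::nat. if n = 1 then x else x')"
    have "\<P>(\<omega> in M. \<forall>i\<in>{1..1}. X i \<omega> = s i) > 0 \<longrightarrow>
        \<P>(\<omega> in M. X (1 + 1) \<omega> = s (1 + 1) \<bar> \<forall>i\<in>{1..1}. X i \<omega> = s i) = P $ s 1 $ s (1 + 1)"
      using chain unfolding markov_chain_def by blast
    then have "\<P>(\<omega> in M. X 2 \<omega> = x' \<bar> X 1 \<omega> = x) = P $ x $ x'"
      using True \<mu> by (simp add: s_def numeral_2_eq_2)
    then show ?thesis
      using True \<mu> by (simp add: cond_prob_def conj_commute field_simps)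
  qed
qed

lemma (in finite_measure) measure_finite_valued:
  assumes "Z \<in> measurable M (count_space UNIV)" "finite A"
  shows "measure M {\<omega> \<in> space M. Z \<omega> \<in> A} = (\<Sum>a\<in>A. measure M {\<omega> \<in> space M. Z \<omega> = a})"
proof -
  have [measurable]: "Z \<in> measurable M (count_space UNIV)" by fact
  have "{\<omega> \<in> space M. Z \<omega> \<in> A} = (\<Union>a\<in>A. {\<omega> \<in> space M. Z \<omega> = a})" by auto
  then show ?thesis
    using \<open>finite A\<close>
    by (simp add: finite_measure_finite_Union disjoint_family_on_def disjoint_iff image_subset_iff)
qed

text \<open>Both conditional entropies become averages with the same weights
  \<open>\<mu> $ x * S $ x $ y'\<close>, one of \<open>- ln S\<close>, the other of
  \<open>- ln Q\<close>, so their difference averages the log-ratio. The factor \<open>ln 2\<close>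
  converts from base 2 to natural logarithms.\<close>

lemma lumpability_cost_eq:
  fixes X :: "nat \<Rightarrow> 'w \<Rightarrow> 'x::finite" and g :: "'x \<Rightarrow> 'y::finite"
    and P :: "real ^ 'x ^ 'x" and Q :: "real ^ 'y ^ 'y"
  defines "S \<equiv> P ** aggregation_matrix g"
  assumes chain: "stationary_markov_chain M X P \<mu>"
    and \<mu>: "\<And>x. \<mu> $ x > 0"
    and \<nu>: "\<And>y. \<nu> $ y = (\<Sum>x | g x = y. \<mu> $ x)" "\<And>y. \<nu> $ y > 0"
    and Q: "\<And>y y'. \<nu> $ y * Q $ y $ y' = (\<Sum>x | g x = y. \<mu> $ x * S $ x $ y')"
    and ac: "\<And>x y'. S $ x $ y' \<noteq> 0 \<Longrightarrow> S $ x $ y' > 0 \<and> Q $ g x $ y' > 0"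
  shows "ln 2 * lumpability_cost M X g
    = (\<Sum>x\<in>UNIV. \<mu> $ x * (\<Sum>y'\<in>UNIV. S $ x $ y' * ln (S $ x $ y' / Q $ g x $ y')))"
proof -
  have mc: "markov_chain M X P" and X1: "\<P>(\<omega> in M. X 1 \<omega> = x) = \<mu> $ x" for x
    using chain by (auto simp: stationary_markov_chain_def)
  interpret prob_space M using mc by (simp add: markov_chain_def)
  have X_meas: "X n \<in> measurable M (count_space UNIV)" if "n \<ge> 1" for n
    using mc that by (simp add: markov_chain_def)
  have gX_meas: "g \<circ> X n \<in> measurable M (count_space UNIV)" if "n \<ge> 1" for n
    using X_meas[OF that] by (rule measurable_comp) simp
  have pair_meas: "(\<lambda>\<omega>. (X 1 \<omega>, X 2 \<omega>)) \<in> measurable M (count_space UNIV)"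
    using measurable_Pair[OF X_meas[of 1] X_meas[of 2]] by (simp add: pair_measure_countable)
  \<comment> \<open>A singleton \<open>A\<close> will give the joint law of the first state and the
    second lumped state, a fibre of \<open>g\<close> that of the two lumped states.\<close>
  have joint: "\<P>(\<omega> in M. (X 1 \<omega>, X 2 \<omega>) \<in> A \<times> {x'. g x' = y'}) = (\<Sum>x\<in>A. \<mu> $ x * S $ x $ y')"
    for A y'
    using measure_finite_valued[OF pair_meas, of "A \<times> {x'. g x' = y'}"]
      stationary_markov_chain_joint[OF chain]
    by (simp add: S_def matrix_aggregation_nth sum_distrib_left sum.cartesian_product split_def
        prod_eq_iff)
  have X1Y2: "\<P>(\<omega> in M. (g \<circ> X 2) \<omega> = y' \<and> X 1 \<omega> = x) = \<mu> $ x * S $ x $ y'" for x y'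
    using joint[of "{x}" y'] by (simp add: conj_commute)
  have Y1Y2: "\<P>(\<omega> in M. (g \<circ> X 2) \<omega> = y' \<and> (g \<circ> X 1) \<omega> = y) = \<nu> $ y * Q $ y $ y'" for y y'
    using joint[of "{x. g x = y}" y'] by (simp add: conj_commute Q)
  have Y1: "\<P>(\<omega> in M. (g \<circ> X 1) \<omega> = y) = \<nu> $ y" for y
    using measure_finite_valued[OF X_meas[of 1], of "{x. g x = y}"] X1 by (simp add: \<nu>)
  have "ln 2 * cond_entropy M (g \<circ> X 2) (X 1)
      = - (\<Sum>x\<in>UNIV. \<Sum>y'\<in>UNIV. \<mu> $ x * S $ x $ y' * ln (S $ x $ y'))"
  proof -
    have "cond_entropy M (g \<circ> X 2) (X 1)
        = - (\<Sum>x\<in>UNIV. \<Sum>y'\<in>UNIV. \<mu> $ x * S $ x $ y' * log 2 (\<mu> $ x * S $ x $ y' / \<mu> $ x))"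
      using cond_entropy_finite[OF prob_space_axioms gX_meas[of 2] X_meas[of 1]]
      unfolding X1Y2 X1 by simp
    then show ?thesis
      using \<mu> by (simp add: log_def sum_distrib_left less_imp_neq[symmetric])
  qed
  moreover have "ln 2 * cond_entropy M (g \<circ> X 2) (g \<circ> X 1)
      = - (\<Sum>x\<in>UNIV. \<Sum>y'\<in>UNIV. \<mu> $ x * S $ x $ y' * ln (Q $ g x $ y'))"
  proof -
    have "cond_entropy M (g \<circ> X 2) (g \<circ> X 1)
        = - (\<Sum>y\<in>UNIV. \<Sum>y'\<in>UNIV. \<nu> $ y * Q $ y $ y' * log 2 (\<nu> $ y * Q $ y $ y' / \<nu> $ y))"
      using cond_entropy_finite[OF prob_space_axioms gX_meas[of 2] gX_meas[of 1]]
      unfolding Y1Y2 Y1 by simp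
    then have "ln 2 * cond_entropy M (g \<circ> X 2) (g \<circ> X 1)
        = - (\<Sum>y\<in>UNIV. \<Sum>y'\<in>UNIV. \<nu> $ y * Q $ y $ y' * ln (Q $ y $ y'))"
      using \<nu>(2) by (simp add: log_def sum_distrib_left less_imp_neq[symmetric])
    \<comment> \<open>Each aggregated weight splits over a fibre of \<open>g\<close>, on which
      \<open>ln Q\<close> is constant; the fibres partition all states, so the sum becomes one over
      \<open>x\<close>.\<close>
    also have "(\<Sum>y\<in>UNIV. \<Sum>y'\<in>UNIV. \<nu> $ y * Q $ y $ y' * ln (Q $ y $ y'))
        = (\<Sum>y\<in>UNIV. \<Sum>y'\<in>UNIV. \<Sum>x | g x = y. \<mu> $ x * S $ x $ y' * ln (Q $ g x $ y'))"
      by (simp add: Q sum_distrib_right)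
    also have "\<dots> = (\<Sum>y\<in>UNIV. \<Sum>x | g x = y. \<Sum>y'\<in>UNIV. \<mu> $ x * S $ x $ y' * ln (Q $ g x $ y'))"
      by (intro sum.cong refl sum.swap)
    also have "\<dots> = (\<Sum>x\<in>UNIV. \<Sum>y'\<in>UNIV. \<mu> $ x * S $ x $ y' * ln (Q $ g x $ y'))"
      using sum.group[of UNIV UNIV g "\<lambda>x. \<Sum>y'\<in>UNIV. \<mu> $ x * S $ x $ y' * ln (Q $ g x $ y')"]
      by (simp only: finite subset_UNIV UNIV_I simp_thms)
    finally show ?thesis .
  qed
  ultimately have "ln 2 * lumpability_cost M X g
      = (\<Sum>x\<in>UNIV. \<Sum>y'\<in>UNIV. \<mu> $ x * S $ x $ y' * (ln (S $ x $ y') - ln (Q $ g x $ y')))"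
    by (simp add: lumpability_cost_def right_diff_distrib sum_subtractf)
  also have "\<dots> = (\<Sum>x\<in>UNIV. \<Sum>y'\<in>UNIV. \<mu> $ x * (S $ x $ y' * ln (S $ x $ y' / Q $ g x $ y')))"
  proof (intro sum.cong refl)
    \<comment> \<open>Where \<open>S\<close> vanishes both sides are 0; elsewhere \<open>ac\<close>
      makes both arguments positive, so the logarithm of the quotient splits.\<close>
    fix x y'
    show "\<mu> $ x * S $ x $ y' * (ln (S $ x $ y') - ln (Q $ g x $ y'))
        = \<mu> $ x * (S $ x $ y' * ln (S $ x $ y' / Q $ g x $ y'))"
      using ac[of x y'] by (cases "S $ x $ y' = 0") (simp_all add: ln_div)
  qed
  finally show ?thesis by (simp add: sum_distrib_left)
qed

section \<open>From the cost to the bisimulation inequality\<close>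

theorem proposition1:
  fixes M :: "'w measure" and X :: "nat \<Rightarrow> 'w \<Rightarrow> 'x::finite"
    and P :: "real ^ 'x ^ 'x" and \<mu> :: "real ^ 'x"
    and g :: "'x \<Rightarrow> 'y::finite"
    and W :: "real ^ 'y ^ 'x" and \<nu> :: "real ^ 'y" and U :: "real ^ 'x ^ 'y"
    and Q :: "real ^ 'y ^ 'y"
    and N :: "'v measure" and Yt :: "nat \<Rightarrow> 'v \<Rightarrow> 'y"
    and \<epsilon> :: real
  assumes "stationary_markov_chain M X P \<mu>"
    and "irreducible_matrix P" and "aperiodic_matrix P"
    and "surj g"
    and "W = aggregation_matrix g"
    and "\<nu> = \<mu> v* W"
    and "U = matrix_inv (diag_matrix \<nu>) ** transpose W ** diag_matrix \<mu>"
    and "Q = U ** P ** W"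
    and "stationary_markov_chain N Yt Q \<nu>"
    and "\<epsilon> = sqrt (ln 2 * lumpability_cost M X g / (2 * Min (range (\<lambda>x. \<mu> $ x))))"
  shows "eps_bisimilar P Q \<epsilon> \<and>
    eps_bisimulation P Q \<epsilon> {(Inr (g x), Inl x) | x. True}"
proof -
  define S where "S = P ** aggregation_matrix g"
  have P: "transition_matrix P" and inv: "invariant_distribution P \<mu>"
    using assms(1) by (auto simp: stationary_markov_chain_def markov_chain_def)
  have Qt: "transition_matrix Q"
    using assms(9) by (auto simp: stationary_markov_chain_def markov_chain_def)
  have \<mu>: "\<mu> $ x > 0" for x
    using invariant_distribution_pos[OF P assms(2) inv] .
  have \<nu>: "\<nu> $ y = (\<Sum>x | g x = y. \<mu> $ x)" for y
    by (simp add: assms(5,6) vector_aggregation_nth)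
  have \<nu>_pos: "\<nu> $ y > 0" for y
    unfolding \<nu> using \<mu> \<open>surj g\<close> by (intro sum_pos) (auto, metis surjD)
  have Q: "\<nu> $ y * Q $ y $ y' = (\<Sum>x | g x = y. \<mu> $ x * S $ x $ y')" for y y'
    unfolding assms(8,7,5) S_def
    by (rule aggregated_transition_nth) (use \<nu>_pos in \<open>simp add: less_imp_neq[symmetric]\<close>)
  have S: "S $ x $ y' = (\<Sum>x' | g x' = y'. P $ x $ x')" for x y'
    by (simp add: S_def matrix_aggregation_nth)
  have S_nonneg: "S $ x $ y' \<ge> 0" for x y'
    unfolding S using P by (auto simp: transition_matrix_def intro: sum_nonneg)
  have S_sum: "(\<Sum>y'\<in>B. S $ x $ y') = (\<Sum>x' | g x' \<in> B. P $ x $ x')" for x B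
  proof -
    have "(\<Sum>x' | g x' \<in> B. P $ x $ x') = (\<Sum>y'\<in>B. \<Sum>x' | x' \<in> {x'. g x' \<in> B} \<and> g x' = y'. P $ x $ x')"
      by (rule sum.group[symmetric]) auto
    also have "\<dots> = (\<Sum>y'\<in>B. S $ x $ y')"
      unfolding S by (intro sum.cong) auto
    finally show ?thesis by simp
  qed
  have Q_nonneg: "Q $ y $ y' \<ge> 0" for y y'
    using Qt by (simp add: transition_matrix_def)
  \<comment> \<open>Row \<open>x\<close> of \<open>S\<close> is absolutely continuous with respect
    to row \<open>g x\<close> of \<open>Q\<close>: the latter is a weighted average of the rows over
    the fibre of \<open>x\<close>, in which \<open>x\<close> has positive weight.\<close>
  have ac: "S $ x $ y' = 0" if "Q $ g x $ y' = 0" for x y'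
  proof -
    have "(\<Sum>z | g z = g x. \<mu> $ z * S $ z $ y') = 0"
      using Q[of "g x" y'] that by simp
    then have "\<forall>z\<in>{z. g z = g x}. \<mu> $ z * S $ z $ y' = 0"
      using \<mu> S_nonneg by (subst (asm) sum_nonneg_eq_0_iff) (auto simp: less_imp_le)
    then show ?thesis using \<mu>[of x] by auto
  qed
  define D where "D x = (\<Sum>y'\<in>UNIV. S $ x $ y' * ln (S $ x $ y' / Q $ g x $ y'))" for x
  have cost: "ln 2 * lumpability_cost M X g = (\<Sum>x\<in>UNIV. \<mu> $ x * D x)"
    unfolding D_def S_def
  proof (rule lumpability_cost_eq[OF assms(1) \<mu> \<nu> \<nu>_pos], fold S_def)
    show "0 < S $ x $ y' \<and> 0 < Q $ g x $ y'" if "S $ x $ y' \<noteq> 0" for x y'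
      using that ac[of x y'] S_nonneg[of x y'] Q_nonneg[of "g x" y'] by force
  qed (rule Q)
  have Pinsker: "2 * ((\<Sum>y'\<in>B. S $ x $ y') - (\<Sum>y'\<in>B. Q $ g x $ y'))\<^sup>2 \<le> D x" for x B
    unfolding D_def
    using S_nonneg Q_nonneg ac S_sum[of x UNIV] P Qt
    by (intro Pinsker_event) (auto simp: transition_matrix_def)
  \<comment> \<open>On the empty event Pinsker's inequality reduces to Gibbs' inequality.\<close>
  have D_nonneg: "D x \<ge> 0" for x
    using Pinsker[where B = "{}"] by simp
  define m where "m = Min (range (\<lambda>x. \<mu> $ x))"
  have m_pos: "m > 0" and m_le: "m \<le> \<mu> $ x" for x
    using \<mu> by (auto simp: m_def)
  have bound: "(\<Sum>y'\<in>B. Q $ g x $ y') - \<epsilon> \<le> (\<Sum>x' | g x' \<in> B. P $ x $ x')" for x B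
  proof -
    define d where "d = (\<Sum>y'\<in>B. Q $ g x $ y') - (\<Sum>y'\<in>B. S $ x $ y')"
    have "m * (2 * d\<^sup>2) \<le> \<mu> $ x * D x"
      using m_le[of x] m_pos Pinsker[of x B]
      by (intro mult_mono) (auto simp: d_def power2_commute)
    also have "\<dots> \<le> (\<Sum>x\<in>UNIV. \<mu> $ x * D x)"
      using \<mu> D_nonneg by (intro member_le_sum) (auto simp: less_imp_le)
    finally have "d\<^sup>2 \<le> ln 2 * lumpability_cost M X g / (2 * m)"
      unfolding cost using m_pos by (simp add: field_simps)
    \<comment> \<open>A bound on the square bounds \<open>d\<close> from above whatever its sign,
      and this one-sided bound is what bisimulation asks for.\<close>
    then have "d \<le> \<epsilon>"
      unfolding assms(10) m_def[symmetric] by (rule real_le_rsqrt)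
    then show ?thesis by (simp add: d_def S_sum)
  qed
  let ?R = "{(Inr (g x), Inl x) | x. True} :: ('x + 'y) rel"
  have "eps_bisimulation P Q \<epsilon> ?R"
    unfolding eps_bisimulation_def
  proof (intro allI impI)
    fix x y and T :: "('x + 'y) set"
    assume "(Inr y, Inl x) \<in> ?R"
    then have "y = g x" by simp
    \<comment> \<open>\<open>?R\<close> leads only from \<open>Inr\<close> states to
      \<open>Inl\<close> states, so the \<open>Inl\<close> part of \<open>T\<close> contributes
      nothing to the image.\<close>
    moreover have "{x'. Inl x' \<in> ?R `` T} = {x'. g x' \<in> {y'. Inr y' \<in> T}}"
      by auto
    ultimately show "(\<Sum>x' | Inl x' \<in> ?R `` T. P $ x $ x') \<ge> (\<Sum>y' | Inr y' \<in> T. Q $ y $ y') - \<epsilon>"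
      using bound[of x "{y'. Inr y' \<in> T}"] by (simp only: mem_Collect_eq)
  qed
  then show ?thesis
    by (auto simp: eps_bisimilar_def)
qed

end
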